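(* Let $D$ be a domain in $\mathbb C$ and let $k,m,p\ge 1$ be natural numbers. (a) Let $\{g_n\}_{n=1}^\infty$ be a sequence of holomorphic functions on $D$ with $g_n\not\equiv 0$, all of whose zeros have multiplicity at least $m$. If $g_n\to 0$ uniformly on compact subsets of $D$, then $$\frac{\left(g_n^{(k)}\right)^m}{g_n^{\,m-k}}\longrightarrow 0\qquad (n\to\infty)$$ uniformly on compact subsets of $D$ (with respect to the Euclidean metric). (b) Let $\{f_n\}_{n=1}^\infty$ be a sequence of meromorphic functions on $D$ all of whose poles have multiplicity at least $p$. If $f_n\to\infty$ uniformly on compact subsets of $D$ with respect to the spherical metric, then $$\frac{\left(f_n^{(k)}\right)^p}{f_n^{\,p+k}}\longrightarrow 0\qquad (n\to\infty)$$ uniformly on compact subsets of $D$ (with respect to the Euclidean metric).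
   Context: A domain is a nonempty open connected subset of $\mathbb C$; $g^{(k)}$ denotes the $k$-th derivative. The exponent $m-k$ in (a) is an integer which may be positive, zero or negative, so the expression in (a) means $(g_n^{(k)})^m\, g_n^{\,k-m}$. The quotients in (a) and (b) are regarded as meromorphic functions, i.e. removable singularities (at zeros of $g_n$, respectively poles of $f_n$) are removed. A sequence of such functions $d_n$ converges to $0$ uniformly on compact subsets of $D$ if for every compact $K\subset D$ and every $\varepsilon>0$ there is an $N$ such that for all $n\ge N$ the function $d_n$ has no pole on $K$ and $|d_n|<\varepsilon$ on $K$. In (b), $f_n\to\infty$ uniformly on compact subsets in the spherical metric means: for every compact $K\subset D$ and every $M>0$ there is an $N$ such that for all $n\ge N$ and all $z\in K$, either $z$ is a pole of $f_n$ or $|f_n(z)|>M$. *)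

theory Defs
  imports "HOL-Complex_Analysis.Complex_Analysis"
begin

text \<open>
  A meromorphic function on an open set is represented by a function that is
  \<open>nicely_meromorphic_on\<close> it: continuous away from its poles, with the dummy value \<open>0\<close> at
  each pole. This representative is unique on the set. Statements about values must therefore
  treat poles explicitly through \<^const>\<open>is_pole\<close>, as the next two definitions do.
\<close>

definition meromorphic_compactly_to_zero :: "complex set \<Rightarrow> (nat \<Rightarrow> complex \<Rightarrow> complex) \<Rightarrow> bool"
  where "meromorphic_compactly_to_zero D d \<longleftrightarrow>
    (\<forall>K. compact K \<and> K \<subseteq> D \<longrightarrow>
      (\<forall>\<epsilon>>0. \<exists>N. \<forall>n\<ge>N. \<forall>z\<in>K. \<not> is_pole (d n) z \<and> norm (d n z) < \<epsilon>))"

definition spherical_compactly_to_infinity :: "complex set \<Rightarrow> (nat \<Rightarrow> complex \<Rightarrow> complex) \<Rightarrow> bool"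
  where "spherical_compactly_to_infinity D f \<longleftrightarrow>
    (\<forall>K. compact K \<and> K \<subseteq> D \<longrightarrow>
      (\<forall>M>0. \<exists>N. \<forall>n\<ge>N. \<forall>z\<in>K. is_pole (f n) z \<or> norm (f n z) > M))"

text \<open>
  The pointwise quotients below take conventional values at zeros of \<open>g\<close> and at poles of \<open>f\<close>;
  \<^const>\<open>remove_sings\<close> replaces these by the limits whenever the singularity is removable. The
  exponent \<open>m - k\<close> may be negative, hence the integer power.
\<close>

definition zero_quotient :: "nat \<Rightarrow> nat \<Rightarrow> (complex \<Rightarrow> complex) \<Rightarrow> complex \<Rightarrow> complex"
  where "zero_quotient k m g =
    remove_sings (\<lambda>z. ((deriv ^^ k) g z) ^ m / g z powi (int m - int k))"

definition pole_quotient :: "nat \<Rightarrow> nat \<Rightarrow> (complex \<Rightarrow> complex) \<Rightarrow> complex \<Rightarrow> complex"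
  where "pole_quotient k p f =
    remove_sings (\<lambda>z. ((deriv ^^ k) f z) ^ p / f z ^ (p + k))"

end

theory Submission
  imports Defs
begin

text \<open>
  The heart of the matter is that an \<open>m\<close>-th root of \<open>g\<close> behaves like a Lipschitz function when
  all zeros of \<open>g\<close> have multiplicity at least \<open>m\<close>, even if \<open>g\<close> has no holomorphic \<open>m\<close>-th root:
  if \<open>\<bar>g\<bar> \<le> M\<close> on a disc of radius \<open>R\<close>, then near its centre \<open>\<bar>g\<bar>\<^sup>1\<^sup>/\<^sup>m\<close> changes at most at
  a rate comparable to \<open>M\<^sup>1\<^sup>/\<^sup>m / R\<close>. To see this, take the largest zero-free disc
  about a point \<open>z0\<close>, of radius \<open>\<delta>\<close> say. A zero on its boundary forces
  \<open>\<bar>g\<bar> \<le> M (4 \<delta> / R)\<^sup>m\<close> on that disc, by the Schwarz lemma for zeros of order at least \<open>m\<close>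
  (\<open>zero_free_disc\<close>). On the disc there is a root \<open>h\<close> with \<open>h\<^sup>m = g\<close>; it is bounded by a multiple
  of \<open>\<delta>\<close>, so the Schwarz lemma for \<open>h - h z0\<close> gives a Lipschitz constant in which \<open>\<delta>\<close>
  has cancelled.

  Hence \<open>\<bar>g\<bar>\<close> stays within a factor \<open>2\<^sup>m\<close> of \<open>a = \<bar>g z0\<bar>\<close> on a disc about \<open>z0\<close> whose radius
  \<open>s\<close> satisfies \<open>s\<^sup>m = a (R / 16)\<^sup>m / M\<close> (\<open>comparable_values_on_disc\<close>). Cauchy's inequality on this
  disc gives \<open>\<bar>g\<^sup>(\<^sup>k\<^sup>) z0\<bar>\<^sup>m \<le> C a\<^sup>m / s\<^sup>m\<^sup>k = C' M\<^sup>k a\<^sup>m\<^sup>-\<^sup>k\<close>, which is the estimate wanted in (a),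
  whatever the sign of \<open>m - k\<close>, with a factor \<open>M\<^sup>k\<close> that tends to \<open>0\<close> with \<open>g\<close>.

  For (b) the same disc is used for \<open>g = 1/f\<close>, whose zeros are the poles of \<open>f\<close>. Since \<open>\<bar>g\<bar>\<close> is
  also bounded below there, \<open>f\<close> is holomorphic and bounded by \<open>2\<^sup>p / a\<close> on the disc, and
  Cauchy's inequality is applied to \<open>f\<close> itself.

  The exceptional points (zeros of \<open>g\<close>, poles of \<open>f\<close>) need no separate computation of orders:
  the estimate holds with the same constant at all nearby points, so it passes to the
  limit (\<open>remove_sings_bounded\<close>).
\<close>

section \<open>Schwarz lemma for zeros of higher order\<close>

text \<open>
  The maximum principle for the cofactor \<open>u\<close> on circles of radius \<open>t\<close>, followed by \<open>t \<rightarrow> r\<close>. The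
  case \<open>m = 1\<close> later provides a Lipschitz bound.
\<close>

lemma norm_le_of_power_factor:
  fixes u :: "complex \<Rightarrow> complex"
  assumes u: "u holomorphic_on ball c r"
    and bound: "\<And>w. w \<in> ball c r \<Longrightarrow> norm ((w - c) ^ m * u w) \<le> M"
    and w: "w \<in> ball c r"
  shows "norm ((w - c) ^ m * u w) \<le> M * (norm (w - c) / r) ^ m"
proof -
  have r: "0 < r" and wr: "norm (w - c) < r"
    using w by (auto simp: dist_norm norm_minus_commute intro: le_less_trans[OF norm_ge_zero])
  have bound_t: "norm (u w) \<le> M / t ^ m" if t: "norm (w - c) < t" "t < r" for t
  proof (rule maximum_modulus_frontier[of u "cball c t"])
    have t0: "0 < t"
      using t(1) norm_ge_zero le_less_trans by blast
    show "u holomorphic_on interior (cball c t)"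
      by (rule holomorphic_on_subset[OF u]) (use t in auto)
    show "continuous_on (closure (cball c t)) u"
      by (rule holomorphic_on_imp_continuous_on, rule holomorphic_on_subset[OF u]) (use t in auto)
    show "w \<in> cball c t"
      using t by (simp add: dist_norm norm_minus_commute)
    fix z assume "z \<in> frontier (cball c t)"
    hence z: "norm (z - c) = t"
      using t0 by (simp add: dist_norm norm_minus_commute)
    have "z \<in> ball c r"
      using z t by (simp add: dist_norm norm_minus_commute)
    from bound[OF this] show "norm (u z) \<le> M / t ^ m"
      using t0 z by (simp add: norm_mult norm_power field_simps)
  qed auto
  have "norm (u w) \<le> M / r ^ m"
  proof (rule tendsto_lowerbound)
    show "((\<lambda>t. M / t ^ m) \<longlongrightarrow> M / r ^ m) (at_left r)"
      using r by (intro tendsto_intros) auto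
    have "\<forall>\<^sub>F t in at_left r. t \<in> {norm (w - c)<..<r}"
      using wr by (rule eventually_at_left_real)
    thus "\<forall>\<^sub>F t in at_left r. norm (u w) \<le> M / t ^ m"
      by eventually_elim (auto intro: bound_t)
  qed auto
  hence "norm (w - c) ^ m * norm (u w) \<le> norm (w - c) ^ m * (M / r ^ m)"
    by (intro mult_left_mono) auto
  thus ?thesis
    by (simp add: norm_mult norm_power power_divide mult_ac)
qed

text \<open>
  The order of a zero describes \<open>f\<close> only near \<open>c\<close>; dividing by \<open>(w - c)\<^sup>m\<close> away from the centre
  extends the cofactor to the whole disc, where the Schwarz lemma needs it.
\<close>

lemma zorder_ge_factorization:
  fixes f :: "complex \<Rightarrow> complex"
  assumes f: "f holomorphic_on ball c r"
    and nz: "z \<in> ball c r" "f z \<noteq> 0" and ord: "zorder f c \<ge> int m"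
  obtains u where "u holomorphic_on ball c r" "\<And>w. w \<in> ball c r \<Longrightarrow> f w = (w - c) ^ m * u w"
proof -
  define n where "n = nat (zorder f c)"
  have mn: "m \<le> n"
    using ord by (simp add: n_def)
  have c: "c \<in> ball c r"
    using nz(1) by (auto intro: le_less_trans[OF zero_le_dist])
  have "\<exists>\<rho>>0. cball c \<rho> \<subseteq> ball c r \<and> zor_poly f c holomorphic_on cball c \<rho> \<and>
      (\<forall>w\<in>cball c \<rho>. f w = zor_poly f c w * (w - c) ^ n \<and> zor_poly f c w \<noteq> 0)"
    using zorder_exist_zero[OF f _ _ c] nz unfolding n_def by blast
  then obtain \<rho> where \<rho>: "\<rho> > 0" "cball c \<rho> \<subseteq> ball c r" "zor_poly f c holomorphic_on cball c \<rho>"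
    and feq: "\<And>w. w \<in> cball c \<rho> \<Longrightarrow> f w = zor_poly f c w * (w - c) ^ n"
    by blast
  \<comment> \<open>The value at \<open>c\<close> is \<open>0\<close> unless the order is exactly \<open>m\<close>, when \<open>0 ^ 0 = 1\<close>.\<close>
  define u where "u w = (if w = c then zor_poly f c c * 0 ^ (n - m) else f w / (w - c) ^ m)" for w
  have split: "(w - c) ^ n = (w - c) ^ m * (w - c) ^ (n - m)" for w
    using mn by (simp flip: power_add)
  have near: "u w = zor_poly f c w * (w - c) ^ (n - m)" if "w \<in> ball c \<rho>" for w
    using that feq[of w] by (cases "w = c") (auto simp: u_def split)
  have "(\<lambda>w. zor_poly f c w * (w - c) ^ (n - m)) holomorphic_on ball c \<rho>"
    by (intro holomorphic_intros holomorphic_on_subset[OF \<rho>(3)]) auto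
  hence 1: "u holomorphic_on ball c \<rho>"
    by (rule holomorphic_transform) (simp add: near)
  have "(\<lambda>w. f w / (w - c) ^ m) holomorphic_on (ball c r - {c})"
    by (intro holomorphic_intros holomorphic_on_subset[OF f]) auto
  hence 2: "u holomorphic_on (ball c r - {c})"
    by (rule holomorphic_transform) (auto simp: u_def)
  have "u holomorphic_on (ball c \<rho> \<union> (ball c r - {c}))"
    using 1 2 by (intro holomorphic_on_Un) (auto intro: open_delete)
  moreover have "ball c r \<subseteq> ball c \<rho> \<union> (ball c r - {c})"
    using \<rho>(1) by auto
  ultimately have "u holomorphic_on ball c r"
    by (rule holomorphic_on_subset)
  moreover have "f w = (w - c) ^ m * u w" if "w \<in> ball c r" for w
  proof (cases "w = c")
    case True
    have "f c = zor_poly f c c * 0 ^ n"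
      using feq[of c] \<rho>(1) by simp
    thus ?thesis
      using True mn by (simp add: u_def flip: power_add)
  qed (simp add: u_def)
  ultimately show ?thesis
    by (rule that)
qed

section \<open>The Lipschitz property of roots\<close>

text \<open>
  Take \<open>\<delta>\<close> to be the distance from \<open>z0\<close> to the nearest zero \<open>\<zeta>\<close>, capped at \<open>R / 4\<close>. If the cap is
  attained, the bound is just \<open>M\<close>; otherwise the disc lies within distance \<open>2 \<delta>\<close> of \<open>\<zeta>\<close>, and the
  Schwarz lemma about \<open>\<zeta>\<close> with radius \<open>R / 2\<close> applies.
\<close>

lemma zero_free_disc:
  fixes g :: "complex \<Rightarrow> complex"
  assumes g: "g holomorphic_on ball z0 R" and R: "0 < R"
    and bound: "\<And>w. w \<in> ball z0 R \<Longrightarrow> norm (g w) \<le> M"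
    and nz: "g z0 \<noteq> 0"
    and ord: "\<And>w. w \<in> ball z0 R \<Longrightarrow> g w = 0 \<Longrightarrow> zorder g w \<ge> int m"
  obtains \<delta> where "0 < \<delta>" "\<delta> \<le> R / 4" "\<And>w. w \<in> ball z0 \<delta> \<Longrightarrow> g w \<noteq> 0"
    "\<And>w. w \<in> ball z0 \<delta> \<Longrightarrow> norm (g w) \<le> M * (4 * \<delta> / R) ^ m"
proof -
  define Z where "Z = {w \<in> cball z0 (R / 4). g w = 0}"
  have sub: "cball z0 (R / 4) \<subseteq> ball z0 R"
    using R by auto
  show ?thesis
  proof (cases "Z = {}")
    case True
    show ?thesis
    proof (rule that[of "R / 4"])
      show "g w \<noteq> 0" if "w \<in> ball z0 (R / 4)" for w
        using True that by (auto simp: Z_def)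
      show "norm (g w) \<le> M * (4 * (R / 4) / R) ^ m" if "w \<in> ball z0 (R / 4)" for w
        using bound[of w] that R sub by auto
    qed (use R in auto)
  next
    case False
    have contg: "continuous_on (cball z0 (R / 4)) g"
      using g sub holomorphic_on_imp_continuous_on holomorphic_on_subset by blast
    have "closed Z"
      unfolding Z_def using contg by (intro continuous_closed_preimage_constant) auto
    then obtain \<zeta> where \<zeta>: "\<zeta> \<in> Z" and min: "\<And>w. w \<in> Z \<Longrightarrow> dist z0 \<zeta> \<le> dist z0 w"
      using distance_attains_inf[OF _ False, of z0] by blast
    define \<delta> where "\<delta> = dist z0 \<zeta>"
    have \<delta>: "0 < \<delta>" "\<delta> \<le> R / 4"
      using \<zeta> nz by (auto simp: \<delta>_def Z_def)
    have sub2: "ball \<zeta> (R / 2) \<subseteq> ball z0 R"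
    proof
      fix w assume "w \<in> ball \<zeta> (R / 2)"
      thus "w \<in> ball z0 R"
        using dist_triangle[of z0 w \<zeta>] \<delta> R by (simp add: \<delta>_def)
    qed
    have "z0 \<in> ball \<zeta> (R / 2)"
      using \<delta> R by (simp add: \<delta>_def dist_commute)
    moreover have "zorder g \<zeta> \<ge> int m"
      using \<zeta> sub by (intro ord) (auto simp: Z_def)
    ultimately obtain u where u: "u holomorphic_on ball \<zeta> (R / 2)"
      and gu: "\<And>w. w \<in> ball \<zeta> (R / 2) \<Longrightarrow> g w = (w - \<zeta>) ^ m * u w"
      using zorder_ge_factorization[OF holomorphic_on_subset[OF g sub2] _ nz] by blast
    have M: "0 \<le> M"
      using bound[of z0] R norm_ge_zero order_trans by (metis centre_in_ball)
    show ?thesis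
    proof (rule that[OF \<delta>])
      fix w assume w: "w \<in> ball z0 \<delta>"
      show "g w \<noteq> 0"
        using min[of w] w \<delta> by (fastforce simp: Z_def \<delta>_def)
      have d: "norm (w - \<zeta>) < 2 * \<delta>"
        using dist_triangle[of w \<zeta> z0] w by (simp add: \<delta>_def dist_norm norm_minus_commute)
      hence wb: "w \<in> ball \<zeta> (R / 2)"
        using \<delta> by (simp add: dist_norm norm_minus_commute)
      have "norm ((w - \<zeta>) ^ m * u w) \<le> M * (norm (w - \<zeta>) / (R / 2)) ^ m"
        using u _ wb by (rule norm_le_of_power_factor) (use bound gu sub2 in \<open>metis subsetD\<close>)
      also have "\<dots> \<le> M * (4 * \<delta> / R) ^ m"
        using M R d by (intro mult_left_mono power_mono) (auto simp: field_simps)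
      finally show "norm (g w) \<le> M * (4 * \<delta> / R) ^ m"
        using gu[OF wb] by simp
    qed
  qed
qed

text \<open>
  The root \<open>h = g\<^sup>1\<^sup>/\<^sup>m\<close> on the zero-free disc has Lipschitz constant \<open>2 B\<close> with
  \<open>B\<^sup>m = M (4 / R)\<^sup>m\<close>, so \<open>h\<close> moves by at most half of \<open>\<bar>h z0\<bar>\<close> within distance
  \<open>\<bar>h z0\<bar> / (4 B)\<close>. The size of the zero-free disc has disappeared from the conclusion.
\<close>

lemma comparable_values_on_disc:
  fixes g :: "complex \<Rightarrow> complex"
  assumes g: "g holomorphic_on ball z0 R" and R: "0 < R" and m: "0 < m"
    and bound: "\<And>w. w \<in> ball z0 R \<Longrightarrow> norm (g w) \<le> M"
    and nz: "g z0 \<noteq> 0"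
    and ord: "\<And>w. w \<in> ball z0 R \<Longrightarrow> g w = 0 \<Longrightarrow> zorder g w \<ge> int m"
  shows "\<exists>s>0. cball z0 s \<subseteq> ball z0 R \<and> s ^ m = norm (g z0) * ((R / 16) ^ m / M) \<and>
    (\<forall>w\<in>cball z0 s. norm (g w) \<le> 2 ^ m * norm (g z0) \<and> norm (g z0) \<le> 2 ^ m * norm (g w))"
proof -
  obtain \<delta> where \<delta>: "0 < \<delta>" "\<delta> \<le> R / 4" and gnz: "\<And>w. w \<in> ball z0 \<delta> \<Longrightarrow> g w \<noteq> 0"
    and gb: "\<And>w. w \<in> ball z0 \<delta> \<Longrightarrow> norm (g w) \<le> M * (4 * \<delta> / R) ^ m"
    using zero_free_disc[OF g R bound nz ord] by blast
  have sub: "ball z0 \<delta> \<subseteq> ball z0 R"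
    using \<delta> R by auto
  have M: "0 < M"
    using bound[of z0] nz R by (metis centre_in_ball less_le_trans zero_less_norm_iff)
  obtain l where l: "l holomorphic_on ball z0 \<delta>" and expl: "\<And>w. w \<in> ball z0 \<delta> \<Longrightarrow> exp (l w) = g w"
    using holomorphic_logarithm_exists[OF _ _ holomorphic_on_subset[OF g sub] gnz, of z0] \<delta>
    by (metis centre_in_ball convex_ball open_ball)
  define h where "h w = exp (l w / of_nat m)" for w
  have h: "h holomorphic_on ball z0 \<delta>"
    unfolding h_def using m by (intro holomorphic_intros l) auto
  have hm: "h w ^ m = g w" if "w \<in> ball z0 \<delta>" for w
    using expl[OF that] m by (simp add: h_def flip: exp_of_nat_mult)
  define B where "B = root m M * 4 / R"
  have B: "0 < B"
    using M R m by (simp add: B_def)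
  have Bm: "B ^ m = M * (4 / R) ^ m"
    using M m by (simp add: B_def power_mult_distrib power_divide)
  \<comment> \<open>This linear dependence on \<open>\<delta>\<close> is where the multiplicity of the zeros enters.\<close>
  have hb: "norm (h w) \<le> B * \<delta>" if "w \<in> ball z0 \<delta>" for w
  proof (rule power_le_imp_le_base)
    have "norm (h w) ^ m \<le> (B * \<delta>) ^ m"
      using gb[OF that] hm[OF that]
      by (simp add: Bm power_mult_distrib power_divide mult_ac flip: norm_power)
    thus "norm (h w) ^ Suc (m - 1) \<le> (B * \<delta>) ^ Suc (m - 1)"
      using m by simp
    show "0 \<le> B * \<delta>"
      using B \<delta> by simp
  qed
  have lipschitz: "norm (h w - h z0) \<le> 2 * B * norm (w - z0)" if w: "w \<in> ball z0 \<delta>" for w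
  proof -
    define u where "u z = (if z = z0 then deriv h z0 else (h z - h z0) / (z - z0))" for z
    have u: "u holomorphic_on ball z0 \<delta>"
      unfolding u_def using h by (intro pole_lemma_open) auto
    have hu: "(z - z0) ^ 1 * u z = h z - h z0" for z
      by (simp add: u_def)
    have "norm ((w - z0) ^ 1 * u w) \<le> (2 * B * \<delta>) * (norm (w - z0) / \<delta>) ^ 1"
      using u _ w
    proof (rule norm_le_of_power_factor)
      fix z assume "z \<in> ball z0 \<delta>"
      hence "norm (h z) + norm (h z0) \<le> 2 * B * \<delta>"
        using hb[of z] hb[of z0] \<delta> by simp
      thus "norm ((z - z0) ^ 1 * u z) \<le> 2 * B * \<delta>"
        unfolding hu using norm_triangle_ineq4 order_trans by blast
    qed
    thus ?thesis
      unfolding hu using \<delta> by simp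
  qed
  define s where "s = norm (h z0) / (4 * B)"
  have h0: "h z0 \<noteq> 0"
    by (simp add: h_def)
  have s: "0 < s" "s \<le> \<delta> / 4"
    using B h0 hb[of z0] \<delta> by (auto simp: s_def field_simps)
  have ss: "cball z0 s \<subseteq> ball z0 \<delta>"
    using s \<delta> by auto
  have close: "norm (h w - h z0) \<le> norm (h z0) / 2" if w: "w \<in> cball z0 s" for w
  proof -
    have "norm (h w - h z0) \<le> 2 * B * norm (w - z0)"
      using lipschitz w ss by blast
    also have "\<dots> \<le> 2 * B * s"
      using w B by (intro mult_left_mono) (auto simp: dist_norm norm_minus_commute)
    finally show ?thesis
      using B by (simp add: s_def)
  qed
  have g0: "norm (g z0) = norm (h z0) ^ m"
    using hm[of z0] \<delta> by (simp flip: norm_power)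
  have gw: "norm (g w) = norm (h w) ^ m" if "w \<in> cball z0 s" for w
    using hm[of w] ss that by (simp add: subset_iff flip: norm_power)
  show ?thesis
  proof (intro exI[of _ s] conjI ballI)
    show "0 < s"
      by (rule s)
    show "cball z0 s \<subseteq> ball z0 R"
      using ss sub by blast
    show "s ^ m = norm (g z0) * ((R / 16) ^ m / M)"
    proof -
      have "(4 * B) ^ m = M * (4 * (4 / R)) ^ m"
        by (simp only: power_mult_distrib Bm mult_ac)
      thus ?thesis
        using R M by (simp add: s_def g0 power_divide)
    qed
    fix w assume w: "w \<in> cball z0 s"
    have "norm (h w) \<le> 2 * norm (h z0)"
      using close[OF w] norm_triangle_sub[of "h w" "h z0"] norm_ge_zero[of "h z0"] by linarith
    hence "norm (h w) ^ m \<le> (2 * norm (h z0)) ^ m"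
      by (rule power_mono) auto
    thus "norm (g w) \<le> 2 ^ m * norm (g z0)"
      by (simp add: gw[OF w] g0 power_mult_distrib)
    have "norm (h z0) \<le> 2 * norm (h w)"
      using close[OF w] norm_triangle_sub[of "h z0" "h w"] by (simp add: norm_minus_commute)
    hence "norm (h z0) ^ m \<le> (2 * norm (h w)) ^ m"
      by (rule power_mono) auto
    thus "norm (g z0) \<le> 2 ^ m * norm (g w)"
      by (simp add: gw[OF w] g0 power_mult_distrib)
  qed
qed

section \<open>Pointwise bounds for the quotients\<close>

lemma Cauchy_inequality_power:
  assumes f: "f holomorphic_on S" "cball z0 s \<subseteq> S" and s: "0 < s"
    and bound: "\<And>w. w \<in> cball z0 s \<Longrightarrow> norm (f w) \<le> b"
  shows "norm ((deriv ^^ k) f z0) ^ m \<le> (fact k * b) ^ m / (s ^ m) ^ k"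
proof -
  have "norm ((deriv ^^ k) f z0) \<le> fact k * b / s ^ k"
  proof (rule Cauchy_inequality)
    show "f holomorphic_on ball z0 s"
      by (rule holomorphic_on_subset[OF f(1)]) (use f(2) in auto)
    show "continuous_on (cball z0 s) f"
      using f holomorphic_on_imp_continuous_on holomorphic_on_subset by blast
    show "norm (f x) \<le> b" if "norm (z0 - x) = s" for x
      using that by (intro bound) (simp add: dist_norm)
  qed fact
  hence "norm ((deriv ^^ k) f z0) ^ m \<le> (fact k * b / s ^ k) ^ m"
    by (rule power_mono) auto
  also have "\<dots> = (fact k * b) ^ m / (s ^ m) ^ k"
    by (simp add: power_divide mult.commute flip: power_mult)
  finally show ?thesis .
qed

lemma zero_quotient_pointwise_bound:
  fixes g :: "complex \<Rightarrow> complex"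
  assumes g: "g holomorphic_on ball z0 R" and R: "0 < R" and m: "0 < m"
    and bound: "\<And>w. w \<in> ball z0 R \<Longrightarrow> norm (g w) \<le> M"
    and nz: "g z0 \<noteq> 0"
    and ord: "\<And>w. w \<in> ball z0 R \<Longrightarrow> g w = 0 \<Longrightarrow> zorder g w \<ge> int m"
  shows "norm (((deriv ^^ k) g z0) ^ m / g z0 powi (int m - int k))
           \<le> (fact k * 2 ^ m) ^ m * (M * (16 / R) ^ m) ^ k"
proof -
  define a where "a = norm (g z0)"
  have a: "0 < a"
    using nz by (simp add: a_def)
  have M: "0 < M"
    using bound[of z0] nz R by (metis centre_in_ball less_le_trans zero_less_norm_iff)
  obtain s where s: "0 < s" "cball z0 s \<subseteq> ball z0 R" "s ^ m = a * ((R / 16) ^ m / M)"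
    and up: "\<And>w. w \<in> cball z0 s \<Longrightarrow> norm (g w) \<le> 2 ^ m * a"
    using comparable_values_on_disc[OF g R m bound nz ord] unfolding a_def by blast
  have "norm ((deriv ^^ k) g z0) ^ m \<le> (fact k * (2 ^ m * a)) ^ m / (s ^ m) ^ k"
    using g s(2,1) up by (rule Cauchy_inequality_power)
  also have "\<dots> = (fact k * 2 ^ m) ^ m * (M * (16 / R) ^ m) ^ k * (a ^ m / a ^ k)"
    using R M a by (simp add: s(3) power_mult_distrib power_divide field_simps)
  also have "a ^ m / a ^ k = a powi (int m - int k)"
    using a by (simp add: power_int_diff)
  finally show ?thesis
    using a by (simp add: norm_divide norm_power norm_power_int divide_le_eq flip: a_def)
qed

text \<open>
  With the dummy value \<open>f w = 0\<close> at a pole, \<open>inverse (f w)\<close> has the correct value \<open>0\<close> there. The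
  condition \<open>f w = 0\<close> below therefore describes poles of \<open>f\<close>.
\<close>

lemma pole_quotient_pointwise_bound:
  fixes f :: "complex \<Rightarrow> complex"
  assumes g: "(\<lambda>w. inverse (f w)) holomorphic_on ball z0 R" and R: "0 < R" and p: "0 < p"
    and bound: "\<And>w. w \<in> ball z0 R \<Longrightarrow> norm (inverse (f w)) \<le> M"
    and nz: "f z0 \<noteq> 0"
    and ord: "\<And>w. w \<in> ball z0 R \<Longrightarrow> f w = 0 \<Longrightarrow> zorder (\<lambda>w. inverse (f w)) w \<ge> int p"
  shows "norm (((deriv ^^ k) f z0) ^ p / f z0 ^ (p + k))
           \<le> (fact k * 2 ^ p) ^ p * (M * (16 / R) ^ p) ^ k"
proof -
  define a where "a = norm (inverse (f z0))"
  have a: "0 < a"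
    using nz by (simp add: a_def)
  have M: "0 < M"
    using bound[of z0] a R unfolding a_def by (metis centre_in_ball less_le_trans)
  have inv_nz: "inverse (f z0) \<noteq> 0"
    using nz by simp
  have inv_ord: "zorder (\<lambda>w. inverse (f w)) w \<ge> int p"
    if "w \<in> ball z0 R" "inverse (f w) = 0" for w
    using ord that by simp
  obtain s where s: "0 < s" "cball z0 s \<subseteq> ball z0 R" "s ^ p = a * ((R / 16) ^ p / M)"
    and lo: "\<And>w. w \<in> cball z0 s \<Longrightarrow> a \<le> 2 ^ p * norm (inverse (f w))"
    using comparable_values_on_disc[OF g R p bound inv_nz inv_ord] unfolding a_def by blast
  have fnz: "f w \<noteq> 0" if "w \<in> cball z0 s" for w
    using lo[OF that] a by auto
  have "(\<lambda>w. inverse (inverse (f w))) holomorphic_on cball z0 s"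
    using fnz by (intro holomorphic_intros holomorphic_on_subset[OF g s(2)]) auto
  hence "f holomorphic_on cball z0 s"
    by simp
  hence "norm ((deriv ^^ k) f z0) ^ p \<le> (fact k * (2 ^ p / a)) ^ p / (s ^ p) ^ k"
  proof (rule Cauchy_inequality_power)
    show "norm (f w) \<le> 2 ^ p / a" if "w \<in> cball z0 s" for w
      using lo[OF that] fnz[OF that] a by (simp add: norm_divide field_simps)
  qed (use s in auto)
  hence "norm ((deriv ^^ k) f z0) ^ p * a ^ (p + k)
           \<le> (fact k * (2 ^ p / a)) ^ p / (s ^ p) ^ k * a ^ (p + k)"
    by (rule mult_right_mono) (use a in auto)
  also have "\<dots> = (fact k * 2 ^ p) ^ p * (M * (16 / R) ^ p) ^ k"
    using R M a by (simp add: s(3) power_mult_distrib power_divide power_add field_simps)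
  finally show ?thesis
    by (simp add: a_def norm_mult norm_power norm_inverse power_inverse divide_inverse)
qed

section \<open>Locally uniform convergence\<close>

lemma remove_sings_bounded:
  assumes F: "F meromorphic_on {z}" and bound: "\<forall>\<^sub>F w in at z. norm (F w) \<le> B"
  shows "\<not> is_pole (remove_sings F) z" "norm (remove_sings F z) \<le> B"
proof -
  have np: "\<not> is_pole F z"
  proof
    assume "is_pole F z"
    hence "filterlim (\<lambda>w. norm (F w)) at_top (at z)"
      unfolding is_pole_def by (rule filterlim_at_infinity_imp_norm_at_top)
    hence "\<forall>\<^sub>F w in at z. norm (F w) > B"
      by (simp add: filterlim_at_top_dense)
    with bound have "\<forall>\<^sub>F w in at z. False"
      by eventually_elim auto
    thus False
      by simp
  qed
  with F obtain c where c: "F \<midarrow>z\<rightarrow> c"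
    using meromorphic_on_not_essential unfolding not_essential_def by blast
  show "\<not> is_pole (remove_sings F) z"
    using np meromorphic_on_isolated_singularity[OF F] by simp
  have "norm c \<le> B"
    using c bound by (intro tendsto_upperbound[OF tendsto_norm]) auto
  thus "norm (remove_sings F z) \<le> B"
    using c by (simp add: remove_sings_eqI)
qed

lemma compact_thickening:
  fixes K :: "complex set"
  assumes "compact K" "K \<subseteq> D" "open D"
  obtains K' R where "compact K'" "K' \<subseteq> D" "0 < R"
    "\<And>z w. z \<in> K \<Longrightarrow> w \<in> ball z R \<Longrightarrow> ball w R \<subseteq> K'"
proof -
  obtain e where e: "0 < e" "(\<Union>x\<in>K. cball x e) \<subseteq> D"
    using compact_subset_open_imp_cball_epsilon_subset[OF assms(1,3,2)] by blast
  show ?thesis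
  proof (rule that)
    show "compact (\<Union>x\<in>K. cball x e)"
      by (rule compact_minkowski_sum_cball) fact
    show "ball w (e / 2) \<subseteq> (\<Union>x\<in>K. cball x e)" if "z \<in> K" "w \<in> ball z (e / 2)" for z w
    proof
      fix v assume "v \<in> ball w (e / 2)"
      hence "v \<in> cball z e"
        using that(2) dist_triangle[of z v w] by simp
      thus "v \<in> (\<Union>x\<in>K. cball x e)"
        using that(1) by blast
    qed
  qed (use e in auto)
qed

lemma small_power_bound:
  fixes A L \<epsilon> :: real
  assumes "0 < \<epsilon>" and "k \<ge> 1"
  obtains M where "0 < M" "A * (M * L) ^ k < \<epsilon>"
proof -
  have "((\<lambda>M. A * (M * L) ^ k) \<longlongrightarrow> A * (0 * L) ^ k) (at_right 0)"
    by (intro tendsto_intros)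
  hence "\<forall>\<^sub>F M in at_right 0. A * (M * L) ^ k < \<epsilon>"
    using assms by (intro order_tendstoD(2)) (auto simp: power_0_left)
  moreover have "\<forall>\<^sub>F M in at_right (0::real). 0 < M"
    by (rule eventually_at_right_less)
  ultimately have "\<forall>\<^sub>F M in at_right 0. 0 < M \<and> A * (M * L) ^ k < \<epsilon>"
    by eventually_elim auto
  thus ?thesis
    using that eventually_happens trivial_limit_at_right_real by blast
qed

lemma zero_quotient_compactly_to_zero:
  fixes g :: "nat \<Rightarrow> complex \<Rightarrow> complex"
  assumes D: "open D" "connected D" and k: "k \<ge> 1" and m: "m \<ge> 1"
    and g: "\<And>n. g n holomorphic_on D"
    and nz: "\<And>n. \<exists>z\<in>D. g n z \<noteq> 0"
    and ord: "\<And>n z. z \<in> D \<Longrightarrow> g n z = 0 \<Longrightarrow> zorder (g n) z \<ge> int m"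
    and lim: "\<And>K. compact K \<Longrightarrow> K \<subseteq> D \<Longrightarrow> uniform_limit K g (\<lambda>_. 0) sequentially"
  shows "meromorphic_compactly_to_zero D (\<lambda>n. zero_quotient k m (g n))"
  unfolding meromorphic_compactly_to_zero_def
proof (intro allI impI, elim conjE)
  fix K :: "complex set" and \<epsilon> :: real
  assume K: "compact K" "K \<subseteq> D" and \<epsilon>: "0 < \<epsilon>"
  obtain K' R where K': "compact K'" "K' \<subseteq> D" and R: "0 < R"
    and thick: "\<And>z w. z \<in> K \<Longrightarrow> w \<in> ball z R \<Longrightarrow> ball w R \<subseteq> K'"
    using compact_thickening[OF K D(1)] by blast
  obtain M where M: "0 < M" and small: "(fact k * 2 ^ m) ^ m * (M * (16 / R) ^ m) ^ k < \<epsilon>"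
    using small_power_bound[OF \<epsilon> k] by blast
  obtain N where N: "\<And>n z. n \<ge> N \<Longrightarrow> z \<in> K' \<Longrightarrow> norm (g n z) < M"
    using uniform_limitD[OF lim[OF K'] M] by (auto simp: eventually_sequentially dist_norm)
  have "\<not> is_pole (zero_quotient k m (g n)) z \<and> norm (zero_quotient k m (g n) z) < \<epsilon>"
    if n: "n \<ge> N" and z: "z \<in> K" for n z
  proof -
    define F where "F w = ((deriv ^^ k) (g n) w) ^ m / g n w powi (int m - int k)" for w
    obtain \<beta> where \<beta>: "\<beta> \<in> D" "g n \<beta> \<noteq> 0"
      using nz by blast
    have ana: "g n analytic_on {z}"
      using g[of n] D z K(2) analytic_at by blast
    have F: "F meromorphic_on {z}"
      unfolding F_def
      by (intro meromorphic_intros analytic_on_imp_meromorphic_on analytic_higher_deriv ana)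
    have "\<forall>\<^sub>F w in at z. g n w \<noteq> 0 \<and> w \<in> D"
      using z K(2) by (intro non_zero_neighbour_alt[OF g D _ \<beta>]) auto
    moreover have "\<forall>\<^sub>F w in at z. w \<in> ball z R"
      using R by (intro eventually_at_in_open') auto
    ultimately have "\<forall>\<^sub>F w in at z. norm (F w) \<le> (fact k * 2 ^ m) ^ m * (M * (16 / R) ^ m) ^ k"
    proof eventually_elim
      case (elim w)
      have sub: "ball w R \<subseteq> K'"
        using thick z elim(2) by blast
      show ?case
        unfolding F_def
      proof (rule zero_quotient_pointwise_bound)
        show "g n holomorphic_on ball w R"
          by (rule holomorphic_on_subset[OF g]) (use sub K' in blast)
        show "norm (g n v) \<le> M" if "v \<in> ball w R" for v
          using N[OF n, of v] that sub by auto
        show "zorder (g n) v \<ge> int m" if "v \<in> ball w R" "g n v = 0" for v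
          using that sub K' by (intro ord) auto
      qed (use R m elim in auto)
    qed
    from remove_sings_bounded[OF F this] show ?thesis
      using small unfolding zero_quotient_def F_def by auto
  qed
  thus "\<exists>N. \<forall>n\<ge>N. \<forall>z\<in>K. \<not> is_pole (zero_quotient k m (g n)) z
          \<and> norm (zero_quotient k m (g n) z) < \<epsilon>"
    by blast
qed

text \<open>
  A pole of \<open>1/f\<close> would be a genuine zero of \<open>f\<close>, whereas the value \<open>0\<close> is only allowed as the
  dummy value at a pole.
\<close>

lemma inverse_analytic_at_if_pole_or_nonzero:
  assumes f: "f nicely_meromorphic_on D" and z: "z \<in> D" and large: "is_pole f z \<or> f z \<noteq> 0"
  shows "(\<lambda>w. inverse (f w)) analytic_on {z}"
proof (rule nicely_meromorphic_on_imp_analytic_at[OF nicely_meromorphic_on_inverse[OF f] z])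
  show "\<not> is_pole (\<lambda>w. inverse (f w)) z"
  proof
    assume "is_pole (\<lambda>w. inverse (f w)) z"
    hence "f \<midarrow>z\<rightarrow> 0"
      by (simp add: is_pole_inverse_iff isolated_zero_def)
    moreover from this have np: "\<not> is_pole f z"
      by (meson at_neq_bot is_pole_def not_tendsto_and_filterlim_at_infinity)
    moreover have "f \<midarrow>z\<rightarrow> f z"
      using f z np by (auto simp: nicely_meromorphic_on_def)
    ultimately show False
      using large LIM_unique by blast
  qed
qed

lemma pole_quotient_compactly_to_zero:
  fixes f :: "nat \<Rightarrow> complex \<Rightarrow> complex"
  assumes D: "open D" and k: "k \<ge> 1" and p: "p \<ge> 1"
    and f: "\<And>n. f n nicely_meromorphic_on D"
    and ord: "\<And>n z. z \<in> D \<Longrightarrow> is_pole (f n) z \<Longrightarrow> zorder (f n) z \<le> - int p"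
    and lim: "spherical_compactly_to_infinity D f"
  shows "meromorphic_compactly_to_zero D (\<lambda>n. pole_quotient k p (f n))"
  unfolding meromorphic_compactly_to_zero_def
proof (intro allI impI, elim conjE)
  fix K :: "complex set" and \<epsilon> :: real
  assume K: "compact K" "K \<subseteq> D" and \<epsilon>: "0 < \<epsilon>"
  obtain K' R where K': "compact K'" "K' \<subseteq> D" and R: "0 < R"
    and thick: "\<And>z w. z \<in> K \<Longrightarrow> w \<in> ball z R \<Longrightarrow> ball w R \<subseteq> K'"
    using compact_thickening[OF K D] by blast
  obtain M where M: "0 < M" and small: "(fact k * 2 ^ p) ^ p * (M * (16 / R) ^ p) ^ k < \<epsilon>"
    using small_power_bound[OF \<epsilon> k] by blast
  obtain N where N: "\<And>n z. n \<ge> N \<Longrightarrow> z \<in> K' \<Longrightarrow> is_pole (f n) z \<or> norm (f n z) > 1 / M"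
    using lim K' M unfolding spherical_compactly_to_infinity_def
    by (metis zero_less_divide_1_iff)
  have "\<not> is_pole (pole_quotient k p (f n)) z \<and> norm (pole_quotient k p (f n) z) < \<epsilon>"
    if n: "n \<ge> N" and z: "z \<in> K" for n z
  proof -
    define F where "F w = ((deriv ^^ k) (f n) w) ^ p / f n w ^ (p + k)" for w
    have zero_imp_pole: "is_pole (f n) v" if "v \<in> K'" "f n v = 0" for v
      using N[OF n that(1)] that(2) M by auto
    have mero: "f n meromorphic_on {v}" if "v \<in> D" for v
      using f[of n] that by (auto simp: nicely_meromorphic_on_def intro: meromorphic_on_subset)
    have F: "F meromorphic_on {z}"
      unfolding F_def using mero z K(2) by (intro meromorphic_intros) auto
    have "\<forall>\<^sub>F w in at z. \<not> is_pole (f n) w"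
      using mero[of z] z K(2) by (auto simp: meromorphic_at_iff intro: eventually_not_pole)
    moreover have "\<forall>\<^sub>F w in at z. w \<in> ball z R"
      using R by (intro eventually_at_in_open') auto
    ultimately have "\<forall>\<^sub>F w in at z. norm (F w) \<le> (fact k * 2 ^ p) ^ p * (M * (16 / R) ^ p) ^ k"
    proof eventually_elim
      case (elim w)
      have sub: "ball w R \<subseteq> K'"
        using thick z elim(2) by blast
      hence wK: "w \<in> K'"
        using R by auto
      show ?case
        unfolding F_def
      proof (rule pole_quotient_pointwise_bound)
        have "(\<lambda>v. inverse (f n v)) analytic_on {v}" if "v \<in> ball w R" for v
          using that sub K' zero_imp_pole by (intro inverse_analytic_at_if_pole_or_nonzero[OF f]) auto
        thus "(\<lambda>v. inverse (f n v)) holomorphic_on ball w R"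
          using analytic_imp_holomorphic analytic_on_analytic_at by blast
        show "norm (inverse (f n v)) \<le> M" if v: "v \<in> ball w R" for v
        proof (cases "f n v = 0")
          case False
          hence "norm (f n v) > 1 / M"
            using N[OF n, of v] v sub K' is_pole_zero_at_nicely_mero[OF f[of n]] by blast
          thus ?thesis
            using M False by (simp add: norm_divide field_simps)
        qed (use M in auto)
        show "f n w \<noteq> 0"
          using zero_imp_pole wK elim(1) by blast
        show "zorder (\<lambda>v. inverse (f n v)) v \<ge> int p" if v: "v \<in> ball w R" "f n v = 0" for v
        proof -
          have vD: "v \<in> D"
            using v sub K' by blast
          have pole: "is_pole (f n) v"
            using zero_imp_pole v sub by blast
          have "zorder (\<lambda>v. inverse (f n v)) v = - zorder (f n) v"
          proof (rule zorder_inverse)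
            show "\<exists>\<^sub>F w in at v. f n w \<noteq> 0"
              using non_zero_neighbour_pole[OF pole] eventually_frequently by force
          qed (use mero[OF vD] in \<open>auto simp: meromorphic_at_iff\<close>)
          thus ?thesis
            using ord[OF vD pole] by simp
        qed
      qed (use R p in auto)
    qed
    from remove_sings_bounded[OF F this] show ?thesis
      using small unfolding pole_quotient_def F_def by auto
  qed
  thus "\<exists>N. \<forall>n\<ge>N. \<forall>z\<in>K. \<not> is_pole (pole_quotient k p (f n)) z
          \<and> norm (pole_quotient k p (f n) z) < \<epsilon>"
    by blast
qed

theorem theorem2:
  fixes D :: "complex set" and k m p :: nat
  assumes "open D" and "connected D" and "D \<noteq> {}"
    and "k \<ge> 1" and "m \<ge> 1" and "p \<ge> 1"
  shows
    "(\<forall>g :: nat \<Rightarrow> complex \<Rightarrow> complex.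
        (\<forall>n. g n holomorphic_on D) \<longrightarrow>
        (\<forall>n. \<exists>z\<in>D. g n z \<noteq> 0) \<longrightarrow>
        (\<forall>n. \<forall>z\<in>D. g n z = 0 \<longrightarrow> zorder (g n) z \<ge> int m) \<longrightarrow>
        (\<forall>K. compact K \<and> K \<subseteq> D \<longrightarrow> uniform_limit K g (\<lambda>_. 0) sequentially) \<longrightarrow>
        meromorphic_compactly_to_zero D (\<lambda>n. zero_quotient k m (g n)))
     \<and>
     (\<forall>f :: nat \<Rightarrow> complex \<Rightarrow> complex.
        (\<forall>n. f n nicely_meromorphic_on D) \<longrightarrow>
        (\<forall>n. \<forall>z\<in>D. is_pole (f n) z \<longrightarrow> zorder (f n) z \<le> - int p) \<longrightarrow>
        spherical_compactly_to_infinity D f \<longrightarrow>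
        meromorphic_compactly_to_zero D (\<lambda>n. pole_quotient k p (f n)))"
proof (intro conjI allI impI)
  fix g :: "nat \<Rightarrow> complex \<Rightarrow> complex"
  assume "\<forall>n. g n holomorphic_on D" "\<forall>n. \<exists>z\<in>D. g n z \<noteq> 0"
    "\<forall>n. \<forall>z\<in>D. g n z = 0 \<longrightarrow> zorder (g n) z \<ge> int m"
    "\<forall>K. compact K \<and> K \<subseteq> D \<longrightarrow> uniform_limit K g (\<lambda>_. 0) sequentially"
  thus "meromorphic_compactly_to_zero D (\<lambda>n. zero_quotient k m (g n))"
    using assms by (intro zero_quotient_compactly_to_zero) auto
next
  fix f :: "nat \<Rightarrow> complex \<Rightarrow> complex"
  assume "\<forall>n. f n nicely_meromorphic_on D"
    "\<forall>n. \<forall>z\<in>D. is_pole (f n) z \<longrightarrow> zorder (f n) z \<le> - int p"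
    "spherical_compactly_to_infinity D f"
  thus "meromorphic_compactly_to_zero D (\<lambda>n. pole_quotient k p (f n))"
    using assms by (intro pole_quotient_compactly_to_zero) auto
qed

end
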